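(* Let $G$ be a connected finite simple graph with minimum degree $\delta(G)\ge 2$, maximum degree $\Delta(G)$, and girth at least $7$. Then $C_{tr}(G)\ge \Delta(G)+1$.
   Context: A set $S\subseteq V$ is a total restrained dominating set (TRD-set) of $G=(V,E)$ if every vertex of $V\setminus S$ is adjacent to at least one vertex of $S$ and to at least one other vertex of $V\setminus S$, and every vertex of $S$ is adjacent to at least one other vertex of $S$. Two disjoint sets $X,Y\subseteq V$ form a total restrained coalition if neither is a TRD-set but $X\cup Y$ is a TRD-set. A trc-partition of $G$ is a partition $\Phi$ of $V$ such that no member of $\Phi$ is a TRD-set and each member forms a total restrained coalition with some other member of $\Phi$. $C_{tr}(G)$ is the maximum cardinality of a trc-partition of $G$. *)

theory Defs
  imports
    "Graph_Theory.Digraph_Component"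
    "HOL-Library.Disjoint_Sets"
    "HOL-Library.Extended_Nat"
begin

text \<open>
  Finite simple graphs are modelled by the locale predicate \<^const>\<open>graph\<close> of the library:
  finite, symmetric, loop-free digraphs without parallel arcs. Each undirected edge
  is a pair of opposite arcs, so adjacency is \<open>u \<rightarrow>\<^bsub>G\<^esub> v\<close> and the degree of a vertex
  is its out-degree.
\<close>

definition min_degree :: "('a, 'b) pre_digraph \<Rightarrow> nat" where
  "min_degree G = Min (out_degree G ` verts G)"

definition max_degree :: "('a, 'b) pre_digraph \<Rightarrow> nat" where
  "max_degree G = Max (out_degree G ` verts G)"

text \<open>
  The library counts \<open>u, v, u\<close> (an edge traversed back and forth) as a cycle; the
  bound \<open>3 \<le> length p\<close> leaves exactly the cycles of the undirected graph.
  The girth of an acyclic graph is \<open>\<infinity>\<close>.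
\<close>

definition girth :: "('a, 'b) pre_digraph \<Rightarrow> enat" where
  "girth G = Inf {enat (length p) | p. pre_digraph.cycle G p \<and> 3 \<le> length p}"

definition trd_set :: "('a, 'b) pre_digraph \<Rightarrow> 'a set \<Rightarrow> bool" where
  "trd_set G S \<longleftrightarrow>
     S \<subseteq> verts G \<and>
     (\<forall>v \<in> verts G - S.
        (\<exists>u \<in> S. v \<rightarrow>\<^bsub>G\<^esub> u) \<and> (\<exists>w \<in> verts G - S. w \<noteq> v \<and> v \<rightarrow>\<^bsub>G\<^esub> w)) \<and>
     (\<forall>v \<in> S. \<exists>u \<in> S. u \<noteq> v \<and> v \<rightarrow>\<^bsub>G\<^esub> u)"

definition tr_coalition :: "('a, 'b) pre_digraph \<Rightarrow> 'a set \<Rightarrow> 'a set \<Rightarrow> bool" where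
  "tr_coalition G X Y \<longleftrightarrow>
     X \<subseteq> verts G \<and> Y \<subseteq> verts G \<and> X \<inter> Y = {} \<and>
     \<not> trd_set G X \<and> \<not> trd_set G Y \<and> trd_set G (X \<union> Y)"

definition trc_partition :: "('a, 'b) pre_digraph \<Rightarrow> 'a set set \<Rightarrow> bool" where
  "trc_partition G \<Phi> \<longleftrightarrow>
     partition_on (verts G) \<Phi> \<and>
     (\<forall>X \<in> \<Phi>. \<not> trd_set G X) \<and>
     (\<forall>X \<in> \<Phi>. \<exists>Y \<in> \<Phi>. Y \<noteq> X \<and> tr_coalition G X Y)"

text \<open>
  A finite graph has only finitely many trc-partitions. If there is none, the maximum
  is the unspecified value \<open>Max {}\<close>, so a lower bound on \<open>C_tr G\<close> can only be obtained
  by exhibiting a trc-partition.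
\<close>

definition C_tr :: "('a, 'b) pre_digraph \<Rightarrow> nat" where
  "C_tr G = Max {card \<Phi> | \<Phi>. trc_partition G \<Phi>}"

end

theory Submission
  imports Defs
begin

text \<open>
  Let \<open>v\<close> have maximum degree and give each neighbour \<open>u\<close> of \<open>v\<close> a private further
  neighbour \<open>w u\<close>. The pairs \<open>{u, w u}\<close> and the set \<open>A\<close> of all remaining vertices form the
  partition, each pair being a coalition partner of \<open>A\<close>. Two edges from a vertex of
  \<open>A - {v}\<close> to the pairs, or a second edge from \<open>w u\<close> to them, would close a cycle of length
  at most 6, so all these vertices have a neighbour in \<open>A\<close>. On the other hand \<open>v\<close> is isolated
  in \<open>A\<close>, and a pair does not dominate the other neighbours of \<open>v\<close>.
\<close>

section \<open>Cycles given by their vertices\<close>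

lemma (in wf_digraph) awalk_of_vertex_list:
  assumes "u \<in> verts G" "successively (\<lambda>x y. x \<rightarrow>\<^bsub>G\<^esub> y) (u # xs)"
  shows "\<exists>p. awalk u p (last (u # xs)) \<and> awalk_verts u p = u # xs"
  using assms
proof (induction xs arbitrary: u)
  case Nil
  then have "awalk u [] u \<and> awalk_verts u [] = [u]"
    by (simp add: awalk_def)
  then show ?case by auto
next
  case (Cons y ys)
  then obtain e where e: "e \<in> arcs G" "tail G e = u" "head G e = y"
    by (auto elim: reachableE)
  have "y \<in> verts G" using e by auto
  with Cons obtain p where p: "awalk y p (last (y # ys))" "awalk_verts y p = y # ys"
    by auto
  have "awalk u (e # p) (last (u # y # ys)) \<and> awalk_verts u (e # p) = u # y # ys"
    using p e Cons.prems by (auto simp: awalk_def)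
  then show ?case by blast
qed

text \<open>\<open>girth\<close> ranges over cycles as arc lists, while the arguments below exhibit
  vertices. Putting \<open>last xs\<close> in front of \<open>xs\<close> turns the closing edge into
  an ordinary step, and \<open>distinct xs\<close> becomes the distinctness of the tail of the
  vertex list that \<open>cycle\<close> asks for.\<close>

lemma (in wf_digraph) girth_le:
  assumes "successively (\<lambda>x y. x \<rightarrow>\<^bsub>G\<^esub> y) (last xs # xs)" "distinct xs" "3 \<le> length xs"
  shows "girth G \<le> enat (length xs)"
proof -
  obtain y ys where xs: "xs = y # ys" using assms(3) by (cases xs) auto
  have "last xs \<rightarrow>\<^bsub>G\<^esub> y" using assms(1) xs by auto
  then have "last xs \<in> verts G" by (rule adj_in_verts)
  from awalk_of_vertex_list[OF this assms(1)] obtain p where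
    p: "awalk (last xs) p (last xs)" "awalk_verts (last xs) p = last xs # xs"
    using xs by auto
  have len: "length p = length xs"
    using arg_cong[OF p(2), of length] by (simp add: length_awalk_verts)
  then have "cycle p"
    using p assms(2,3) by (auto simp: cycle_def)
  then show ?thesis
    unfolding girth_def using len assms(3) by (intro Inf_lower CollectI exI[of _ p]) simp
qed

section \<open>Neighbourhoods and the maximum \<open>C_tr\<close>\<close>

lemma (in nomulti_digraph) out_degree_eq_card_neighbours:
  "out_degree G v = card {u. v \<rightarrow>\<^bsub>G\<^esub> u}"
proof -
  have "inj_on (head G) (out_arcs G v)"
    by (auto simp: inj_on_def arc_to_ends_def intro: no_multi_arcs)
  moreover have "head G ` out_arcs G v = {u. v \<rightarrow>\<^bsub>G\<^esub> u}"
    by (force elim: reachableE simp: arcs_ends_conv)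
  ultimately show ?thesis
    unfolding out_degree_def by (metis card_image)
qed

lemma (in graph) another_neighbour:
  assumes "2 \<le> min_degree G" "x \<in> verts G"
  shows "\<exists>z. x \<rightarrow>\<^bsub>G\<^esub> z \<and> z \<noteq> y"
proof (rule ccontr)
  assume "\<not> ?thesis"
  then have "card {u. x \<rightarrow>\<^bsub>G\<^esub> u} \<le> card {y}"
    by (intro card_mono) auto
  moreover have "min_degree G \<le> out_degree G x"
    unfolding min_degree_def using assms(2) by (intro Min_le) auto
  ultimately show False
    using assms(1) out_degree_eq_card_neighbours[of x] by simp
qed

lemma (in graph) trc_partition_card_le_C_tr:
  assumes "trc_partition G \<Phi>"
  shows "card \<Phi> \<le> C_tr G"
proof -
  have "{\<Phi>. trc_partition G \<Phi>} \<subseteq> Pow (Pow (verts G))"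
    by (auto simp: trc_partition_def partition_on_def)
  then have "finite {\<Phi>. trc_partition G \<Phi>}"
    by (rule finite_subset) simp
  then show ?thesis
    unfolding C_tr_def using assms by (intro Max_ge) auto
qed

section \<open>The partition around a vertex\<close>

lemma (in graph) ex_trc_partition_of_out_degree:
  assumes min2: "2 \<le> min_degree G" and girth7: "7 \<le> girth G" and v: "v \<in> verts G"
  shows "\<exists>\<Phi>. trc_partition G \<Phi> \<and> card \<Phi> = out_degree G v + 1"
proof -
  note sym = arcs_ends_symmetric[OF sym_arcs]
  have irr: "a \<noteq> b" if "a \<rightarrow>\<^bsub>G\<^esub> b" for a b using that adj_not_same by blast
  have inV: "a \<in> verts G" "b \<in> verts G" if "a \<rightarrow>\<^bsub>G\<^esub> b" for a b
    using that by (auto intro: adj_in_verts)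
  have no_short_cycle: False
    if "successively (\<lambda>x y. x \<rightarrow>\<^bsub>G\<^esub> y) (last xs # xs)" "distinct xs" "3 \<le> length xs"
      "length xs \<le> 6" for xs
  proof -
    have "enat 7 \<le> enat (length xs)"
      using girth_le[OF that(1-3)] girth7 by (metis numeral_eq_enat order_trans)
    then show False using that(4) by simp
  qed
  have no3: False if "a \<rightarrow>\<^bsub>G\<^esub> b" "b \<rightarrow>\<^bsub>G\<^esub> c" "c \<rightarrow>\<^bsub>G\<^esub> a" for a b c
    using no_short_cycle[of "[a, b, c]"] that irr by auto
  \<comment> \<open>Adjacent vertices differ, so only opposite ones can coincide. A closed 4-walk
    may retrace an edge, hence the disjunction.\<close>
  have no4: "a = c \<or> b = d"
    if "a \<rightarrow>\<^bsub>G\<^esub> b" "b \<rightarrow>\<^bsub>G\<^esub> c" "c \<rightarrow>\<^bsub>G\<^esub> d" "d \<rightarrow>\<^bsub>G\<^esub> a" for a b c d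
    using no_short_cycle[of "[a, b, c, d]"] that irr by auto
  \<comment> \<open>If two non-consecutive vertices of a closed 5-walk coincide, part of the walk is
    a triangle, which \<open>no3\<close> excludes.\<close>
  have no5: False
    if "a \<rightarrow>\<^bsub>G\<^esub> b" "b \<rightarrow>\<^bsub>G\<^esub> c" "c \<rightarrow>\<^bsub>G\<^esub> d" "d \<rightarrow>\<^bsub>G\<^esub> e" "e \<rightarrow>\<^bsub>G\<^esub> a" for a b c d e
  proof (cases "distinct [a, b, c, d, e]")
    case True
    then show False using no_short_cycle[of "[a, b, c, d, e]"] that by auto
  next
    case False
    then show False using that irr no3 by auto
  qed
  \<comment> \<open>Closed 6-walks can again retrace edges, so distinctness is left to be checked
    where this is applied.\<close>
  have no6: "\<not> distinct [a, b, c, d, e, f]"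
    if "a \<rightarrow>\<^bsub>G\<^esub> b" "b \<rightarrow>\<^bsub>G\<^esub> c" "c \<rightarrow>\<^bsub>G\<^esub> d" "d \<rightarrow>\<^bsub>G\<^esub> e" "e \<rightarrow>\<^bsub>G\<^esub> f" "f \<rightarrow>\<^bsub>G\<^esub> a"
    for a b c d e f
    using no_short_cycle[of "[a, b, c, d, e, f]"] that by auto

  define N where "N = {u. v \<rightarrow>\<^bsub>G\<^esub> u}"
  have "\<forall>u\<in>N. \<exists>z. u \<rightarrow>\<^bsub>G\<^esub> z \<and> z \<noteq> v"
    using another_neighbour[OF min2] inV by (auto simp: N_def)
  then obtain w where w: "\<And>u. u \<in> N \<Longrightarrow> u \<rightarrow>\<^bsub>G\<^esub> w u \<and> w u \<noteq> v" by metis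
  have vN: "v \<rightarrow>\<^bsub>G\<^esub> u" "u \<rightarrow>\<^bsub>G\<^esub> v" if "u \<in> N" for u
    using that sym by (auto simp: N_def)
  have uw: "u \<rightarrow>\<^bsub>G\<^esub> w u" "w u \<rightarrow>\<^bsub>G\<^esub> u" "w u \<noteq> v" if "u \<in> N" for u
    using that w sym by blast+
  have w_notin_N: "w u \<notin> N" if "u \<in> N" for u
    using no3[OF vN(1)[OF that] uw(1)[OF that]] vN(2) by blast
  have v_notin_N: "v \<notin> N" using irr by (auto simp: N_def)
  \<comment> \<open>The closed walk \<open>v\<close>, \<open>u\<close>, \<open>w u\<close>,
    \<open>u'\<close> has \<open>w u\<close> different from \<open>v\<close>, so \<open>no4\<close>
    forces its other two vertices together.\<close>
  have w_inj: "u = u'" if "u \<in> N" "u' \<in> N" "w u = w u'" for u u'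
    using no4[OF vN(1) uw(1), of u u'] that uw vN by metis
  have finN: "finite N"
    by (rule finite_subset[of _ "verts G"]) (auto simp: N_def inV)

  define P where "P u = {u, w u}" for u
  define B where "B = (\<Union>u\<in>N. P u)"
  define A where "A = verts G - B"
  have PV: "P u \<subseteq> verts G" if "u \<in> N" for u
    using inV[OF uw(1)[OF that]] by (auto simp: P_def)
  have P_disj: "P u \<inter> P u' = {}" if "u \<in> N" "u' \<in> N" "u \<noteq> u'" for u u'
    using that w_inj w_notin_N by (auto simp: P_def)
  have vB: "v \<notin> B" using v_notin_N uw(3) by (auto simp: B_def P_def)
  have vA: "v \<in> A" using vB v by (simp add: A_def)

  \<comment> \<open>Continuing from \<open>a\<close> and \<open>b\<close> to \<open>v\<close> inside
    their pairs closes a walk through \<open>x\<close>, of length 4 plus the number of those among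
    \<open>a\<close>, \<open>b\<close> that are second vertices \<open>w i\<close>,
    \<open>w j\<close>.\<close>
  have one_leg: "a = b"
    if x: "x \<notin> B" "x \<noteq> v" and a: "a \<in> B" "x \<rightarrow>\<^bsub>G\<^esub> a" and b: "b \<in> B" "x \<rightarrow>\<^bsub>G\<^esub> b" for x a b
  proof -
    obtain i j where i: "i \<in> N" "a \<in> P i" and j: "j \<in> N" "b \<in> P j"
      using a b by (auto simp: B_def)
    have xi: "x \<noteq> i" "x \<noteq> w i" and xj: "x \<noteq> j" "x \<noteq> w j"
      using x i j by (auto simp: B_def P_def)
    note ei = vN[OF i(1)] uw[OF i(1)] and ej = vN[OF j(1)] uw[OF j(1)]
    note ab = a(2) b(2) sym[OF a(2)] sym[OF b(2)]
    consider "a = i" "b = j" | "a = i" "b = w j" | "a = w i" "b = j" | "a = w i" "b = w j"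
      using i j by (auto simp: P_def)
    then show ?thesis
    proof cases
      case 1
      then show ?thesis using no4[of v i x j] ei ej ab x by auto
    next
      case 2
      then show ?thesis using no5[of v i x "w j" j] ei ej ab by auto
    next
      case 3
      then show ?thesis using no5[of v i "w i" x j] ei ej ab by auto
    next
      case 4
      \<comment> \<open>For \<open>i = j\<close> the 6-walk degenerates, but then both edges end in
        \<open>w i\<close>.\<close>
      show ?thesis
      proof (cases "i = j")
        case True
        then show ?thesis using 4 by simp
      next
        case False
        then have "distinct [v, i, w i, x, w j, j]"
          using x xi xj ei ej w_notin_N i(1) j(1) w_inj[of i j] irr v_notin_N by auto
        then show ?thesis using no6[of v i "w i" x "w j" j] ei ej ab 4 by auto
      qed
    qed
  qed
  \<comment> \<open>An edge from \<open>w u\<close> to \<open>j\<close> or \<open>w j\<close> closes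
    a walk of length 4 or 5 through \<open>v\<close>; only \<open>j = u\<close> in the first case
    survives. Hence every neighbour of \<open>w u\<close> other than \<open>u\<close> lies in
    \<open>A\<close>.\<close>
  have w_leaf: "b = u" if u: "u \<in> N" and b: "b \<in> B" "w u \<rightarrow>\<^bsub>G\<^esub> b" for u b
  proof -
    obtain j where j: "j \<in> N" "b \<in> P j" using b by (auto simp: B_def)
    note eu = vN[OF u] uw[OF u] and ej = vN[OF j(1)] uw[OF j(1)]
    consider "b = j" | "b = w j" using j by (auto simp: P_def)
    then show ?thesis
    proof cases
      case 1
      then show ?thesis using no4[of v u "w u" j] eu ej b by auto
    next
      case 2
      then show ?thesis using no5[of v u "w u" "w j" j] eu ej b by auto
    qed
  qed

  have trd: "trd_set G (A \<union> P u)" if u: "u \<in> N" for u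
    unfolding trd_set_def
  proof (intro conjI ballI)
    show "A \<union> P u \<subseteq> verts G" using PV[OF u] by (auto simp: A_def)
  next
    fix x assume "x \<in> verts G - (A \<union> P u)"
    then obtain j where j: "j \<in> N" "x \<in> P j" "j \<noteq> u" by (auto simp: A_def B_def)
    \<comment> \<open>The whole pair of \<open>x\<close> stays outside, so its two members serve as
      each other's outside neighbour.\<close>
    have Pj: "P j \<subseteq> verts G - (A \<union> P u)"
      using PV[OF j(1)] P_disj[OF j(1) u j(3)] j(1) by (auto simp: A_def B_def)
    consider "x = j" | "x = w j" using j by (auto simp: P_def)
    then show "\<exists>y\<in>A \<union> P u. x \<rightarrow>\<^bsub>G\<^esub> y"
    proof cases
      case 1
      then show ?thesis using vA vN(2)[OF j(1)] by blast
    next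
      case 2
      have "x \<in> verts G" using inV uw(1)[OF j(1)] 2 by blast
      then obtain y where y: "x \<rightarrow>\<^bsub>G\<^esub> y" "y \<noteq> j"
        using another_neighbour[OF min2] by blast
      then have "y \<notin> B" using w_leaf[OF j(1)] 2 by blast
      then have "y \<in> A" using inV(2)[OF y(1)] by (simp add: A_def)
      then show ?thesis using y by blast
    qed
    show "\<exists>y\<in>verts G - (A \<union> P u). y \<noteq> x \<and> x \<rightarrow>\<^bsub>G\<^esub> y"
    proof -
      have "\<exists>y\<in>P j. x \<rightarrow>\<^bsub>G\<^esub> y" using j(2) uw[OF j(1)] by (auto simp: P_def)
      then obtain y where "y \<in> P j" "x \<rightarrow>\<^bsub>G\<^esub> y" by blast
      then show ?thesis using Pj irr[of x y] by (intro bexI[of _ y]) auto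
    qed
  next
    fix x assume x: "x \<in> A \<union> P u"
    have "\<exists>y\<in>A \<union> P u. x \<rightarrow>\<^bsub>G\<^esub> y"
    proof (cases "x \<in> P u \<or> x = v")
      case True
      \<comment> \<open>The members of the pair support each other, and \<open>v\<close>, isolated
        in \<open>A\<close>, is supported by \<open>u\<close>.\<close>
      then show ?thesis using uw[OF u] vN[OF u] by (auto simp: P_def)
    next
      case False
      then have xA: "x \<in> verts G" "x \<notin> B" "x \<noteq> v" using x by (auto simp: A_def)
      obtain y where y: "x \<rightarrow>\<^bsub>G\<^esub> y" using another_neighbour[OF min2 xA(1)] by blast
      obtain z where z: "x \<rightarrow>\<^bsub>G\<^esub> z" "z \<noteq> y" using another_neighbour[OF min2 xA(1)] by blast
      \<comment> \<open>Of two distinct neighbours at most one lies in \<open>B\<close>, so the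
        other one lies in \<open>A\<close>.\<close>
      have "y \<notin> B \<or> z \<notin> B" using one_leg[OF xA(2,3) _ y _ z(1)] z(2) by blast
      then show ?thesis using y z inV by (auto simp: A_def)
    qed
    then show "\<exists>y\<in>A \<union> P u. y \<noteq> x \<and> x \<rightarrow>\<^bsub>G\<^esub> y" using irr by (metis (no_types))
  qed

  have notA: "\<not> trd_set G A"
  proof
    assume "trd_set G A"
    then obtain y where "y \<in> A" "v \<rightarrow>\<^bsub>G\<^esub> y" using vA by (auto simp: trd_set_def)
    then show False by (auto simp: A_def B_def P_def N_def)
  qed
  have notP: "\<not> trd_set G (P u)" if u: "u \<in> N" for u
  proof
    assume t: "trd_set G (P u)"
    \<comment> \<open>A second neighbour \<open>j\<close> of \<open>v\<close> cannot be dominated by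
      the pair: an edge to \<open>u\<close> closes a triangle with \<open>v\<close>, one to
      \<open>w u\<close> a 4-cycle.\<close>
    obtain j where j: "j \<in> N" "j \<noteq> u"
      using another_neighbour[OF min2 v] by (auto simp: N_def)
    then have "j \<in> verts G - P u"
      using PV[OF j(1)] P_disj[OF j(1) u j(2)] by (auto simp: P_def)
    then obtain y where y: "y \<in> P u" "j \<rightarrow>\<^bsub>G\<^esub> y"
      using t unfolding trd_set_def by blast
    consider "y = u" | "y = w u" using y by (auto simp: P_def)
    then show False
    proof cases
      case 1
      then show False using no3[of v j u] vN[OF j(1)] vN[OF u] y by auto
    next
      case 2
      then show False using no4[of v j "w u" u] vN[OF j(1)] vN[OF u] uw[OF u] y j(2) by auto
    qed
  qed

  define \<Phi> where "\<Phi> = insert A (P ` N)"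
  have A_P: "A \<inter> P u = {}" "A \<noteq> P u" if "u \<in> N" for u
    using that vA vB by (auto simp: A_def B_def)
  have coal: "tr_coalition G A (P u)" "tr_coalition G (P u) A" if u: "u \<in> N" for u
    using trd[OF u] notA notP[OF u] PV[OF u] A_P[OF u]
    by (auto simp: tr_coalition_def Un_commute Int_commute A_def)
  have "partition_on (verts G) \<Phi>"
  proof (rule partition_onI)
    show "\<Union>\<Phi> = verts G" using PV by (auto simp: \<Phi>_def A_def B_def)
    show "disjnt p q" if "p \<in> \<Phi>" "q \<in> \<Phi>" "p \<noteq> q" for p q
      using that A_P(1) P_disj unfolding \<Phi>_def disjnt_def by blast
    show "{} \<notin> \<Phi>"
      using vA by (auto simp: \<Phi>_def P_def)
  qed
  moreover have "\<exists>Y\<in>\<Phi>. Y \<noteq> X \<and> tr_coalition G X Y" if "X \<in> \<Phi>" for X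
  proof (cases "X = A")
    case True
    \<comment> \<open>\<open>A\<close> has a partner because \<open>v\<close> has a
      neighbour.\<close>
    obtain u where "u \<in> N" using another_neighbour[OF min2 v] by (auto simp: N_def)
    then show ?thesis
      using True coal(1) A_P(2) by (intro bexI[of _ "P u"]) (auto simp: \<Phi>_def)
  next
    case False
    then obtain u where "u \<in> N" "X = P u" using \<open>X \<in> \<Phi>\<close> by (auto simp: \<Phi>_def)
    then show ?thesis
      using coal(2) A_P(2) by (intro bexI[of _ A]) (auto simp: \<Phi>_def)
  qed
  ultimately have "trc_partition G \<Phi>"
    using notA notP by (auto simp: trc_partition_def \<Phi>_def)
  \<comment> \<open>Disjoint nonempty pairs are distinct, so they contribute the degree of
    \<open>v\<close>, and \<open>A\<close> contributes the additional 1.\<close>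
  moreover have "card \<Phi> = card N + 1"
  proof -
    have "inj_on P N"
      using P_disj by (auto simp: inj_on_def P_def)
    then have "card (P ` N) = card N" by (rule card_image)
    moreover have "A \<notin> P ` N" using A_P(2) by blast
    ultimately show ?thesis using finN by (simp add: \<Phi>_def)
  qed
  ultimately show ?thesis
    using out_degree_eq_card_neighbours[of v] by (auto simp: N_def)
qed

theorem theorem2p8:
  fixes G :: "('a, 'b) pre_digraph"
  assumes "graph G"
    and "Digraph_Component.connected G"
    and "2 \<le> min_degree G"
    and "7 \<le> girth G"
  shows "max_degree G + 1 \<le> C_tr G"
proof -
  interpret graph G by fact
  \<comment> \<open>Connectedness includes having a vertex, so the \<open>Max\<close> in
    \<open>max_degree\<close> is attained.\<close>
  have "verts G \<noteq> {}"
    using assms(2) by (auto simp: connected_def strongly_connected_def)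
  then have "max_degree G \<in> out_degree G ` verts G"
    unfolding max_degree_def by (intro Max_in) auto
  then obtain v where "v \<in> verts G" "max_degree G = out_degree G v" by auto
  then show ?thesis
    using ex_trc_partition_of_out_degree[OF assms(3,4)] trc_partition_card_le_C_tr by metis
qed

end
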